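(* Let $k\ge 0$ be an integer, let $G$ be any connected graph on $k+1$ vertices, and let $S_k$ be the star graph with $k$ edges (one center vertex adjacent to $k$ leaves). Then for every graph $H$, \[ \sharp\operatorname{hom}(G,H)\le \sharp\operatorname{hom}(S_k,H). \]
   Context: All graphs are finite, simple and undirected. For graphs $G$ and $H$, $\operatorname{hom}(G,H)$ is the set of graph homomorphisms from $G$ to $H$, i.e. maps $f:V(G)\to V(H)$ such that $\{u,v\}\in E(G)$ implies $\{f(u),f(v)\}\in E(H)$, and $\sharp\operatorname{hom}(G,H)$ denotes its cardinality. *)

theory Defs
  imports "HOL-Library.FuncSet" "Graph_Theory.Digraph_Component"
begin

text \<open>
  Finite simple undirected graphs are the \<^locale>\<open>pair_graph\<close>s of Graph\_Theory: an undirected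
  edge is represented by its two orientations in \<^const>\<open>parcs\<close>.
\<close>

text \<open>
  Functions are taken extensional (undefined outside the vertices of the source), so that each
  map between the vertex sets is counted exactly once.
\<close>

definition graph_homs :: "'a pair_pre_digraph \<Rightarrow> 'b pair_pre_digraph \<Rightarrow> ('a \<Rightarrow> 'b) set" where
  "graph_homs G H =
     {f \<in> pverts G \<rightarrow>\<^sub>E pverts H. \<forall>u v. (u, v) \<in> parcs G \<longrightarrow> (f u, f v) \<in> parcs H}"

definition star_graph :: "nat \<Rightarrow> nat pair_pre_digraph" where
  "star_graph k =
     \<lparr> pverts = {0..k}, parcs = (\<lambda>i. (0, i)) ` {1..k} \<union> (\<lambda>i. (i, 0)) ` {1..k} \<rparr>"

lemma pair_graph_star_graph: "pair_graph (star_graph k)"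
  by unfold_locales (auto simp: star_graph_def symmetric_def sym_def)

lemma finite_graph_homs:
  assumes "pair_graph G" "pair_graph H"
  shows "finite (graph_homs G H)"
proof -
  interpret G: pair_graph G by fact
  interpret H: pair_graph H by fact
  have "finite (pverts G \<rightarrow>\<^sub>E pverts H)"
    by (intro finite_PiE G.pair_finite_verts H.pair_finite_verts)
  then show ?thesis
    by (rule rev_finite_subset) (auto simp: graph_homs_def)
qed

end

theory Submission
  imports Defs
begin

text \<open>
  Write \<open>d x\<close> for the degree of \<open>x\<close> in \<open>H\<close>. The star side is \<open>\<Sum>x. d x ^ k\<close>, and more generally
  every weight \<open>a\<close> on the vertices of \<open>G\<close> satisfies
  \<open>(\<Sum>f. \<Prod>v. d (f v) ^ a v) \<le> (\<Sum>x. d x ^ (k + \<Sum>a))\<close>, the sum on the left ranging over homomorphisms.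
  A connected graph with at least two vertices has two vertices \<open>l\<close>, \<open>m\<close> whose removal leaves it
  connected. By weighted AM-GM the left-hand side is at most a convex combination of the
  sums for the two weights in which \<open>l\<close> or \<open>m\<close> gives all its weight to the other one. A removable
  vertex of weight 0 can then be deleted: summing over its images contributes at most a factor
  \<open>d (f p)\<close> for a neighbour \<open>p\<close>, so the weight of \<open>p\<close> increases by one, and induction applies.
\<close>

section \<open>Weighted AM-GM without division\<close>

text \<open>Factor \<open>x ^ a - y ^ a\<close> as \<open>x - y\<close> times \<open>a\<close>
  monomials. Replacing every remaining \<open>y\<close> by \<open>x\<close> can only increase the
  product with \<open>x - y\<close>, whichever sign that difference has.\<close>

lemma power_mult_diff_le:
  fixes x y :: int
  assumes "0 \<le> x" "0 \<le> y"
  shows "y ^ (b + 1) * (x ^ a - y ^ a) \<le> int a * x ^ (a + b) * (x - y)"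
proof (induction a)
  case 0
  then show ?case by simp
next
  case (Suc a)
  have "y ^ (a + b + 1) * (x - y) \<le> x ^ (a + b + 1) * (x - y)"
  proof (cases "y \<le> x")
    case True
    then show ?thesis using assms by (intro mult_right_mono power_mono) auto
  next
    case False
    then show ?thesis using assms by (intro mult_right_mono_neg power_mono) auto
  qed
  moreover have "x * (y ^ (b + 1) * (x ^ a - y ^ a)) \<le> x * (int a * x ^ (a + b) * (x - y))"
    using Suc assms by (intro mult_left_mono) auto
  ultimately show ?case by (simp add: algebra_simps power_add)
qed

text \<open>Going from \<open>b\<close> to \<open>Suc b\<close>, the induction hypothesis times
  \<open>y\<close> leaves exactly the gap bounded by \<open>power_mult_diff_le\<close>. Integers are
  used because \<open>x - y\<close> may be negative.\<close>

lemma weighted_AM_GM_int: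
  fixes x y :: int
  assumes "0 \<le> x" "0 \<le> y"
  shows "int (a + b) * (x ^ a * y ^ b) \<le> int a * x ^ (a + b) + int b * y ^ (a + b)"
proof (induction b)
  case 0
  then show ?case by simp
next
  case (Suc b)
  have "y * (int (a + b) * (x ^ a * y ^ b)) \<le> y * (int a * x ^ (a + b) + int b * y ^ (a + b))"
    using Suc assms by (intro mult_left_mono) auto
  then show ?case
    using power_mult_diff_le[OF assms, of b a] by (simp add: algebra_simps power_add)
qed

lemma weighted_AM_GM_nat:
  fixes x y :: nat
  shows "(a + b) * (x ^ a * y ^ b) \<le> a * x ^ (a + b) + b * y ^ (a + b)"
proof -
  have "int ((a + b) * (x ^ a * y ^ b)) \<le> int (a * x ^ (a + b) + b * y ^ (a + b))"
    using weighted_AM_GM_int[of "int x" "int y" a b] by simp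
  then show ?thesis by (simp only: of_nat_le_iff)
qed

text \<open>Connectivity by cuts, which makes no reference to walks; the empty set counts as connected.\<close>

definition set_connected :: "('a \<times> 'a) set \<Rightarrow> 'a set \<Rightarrow> bool" where
  "set_connected E V \<longleftrightarrow>
     (\<forall>S. S \<subset> V \<longrightarrow> S \<noteq> {} \<longrightarrow> (\<exists>x\<in>S. \<exists>y\<in>V - S. (x, y) \<in> E))"

lemma set_connectedE:
  assumes "set_connected E V" "S \<subset> V" "S \<noteq> {}"
  obtains x y where "x \<in> S" "y \<in> V" "y \<notin> S" "(x, y) \<in> E"
proof -
  have "\<exists>x\<in>S. \<exists>y\<in>V - S. (x, y) \<in> E"
    using assms(1-3) by (simp add: set_connected_def)
  then show thesis using that by blast
qed

lemma set_connected_insert: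
  assumes "sym E" "set_connected E V" "p \<in> V" "(p, x) \<in> E"
  shows "set_connected E (insert x V)"
  unfolding set_connected_def
proof (intro allI impI)
  fix S assume S: "S \<subset> insert x V" "S \<noteq> {}"
  have xp: "(x, p) \<in> E" using assms by (auto dest: symD)
  \<comment> \<open>The first two cases amount to \<open>S = {x}\<close> and \<open>S = V\<close>,
    where the edge between \<open>x\<close> and \<open>p\<close> crosses the cut.\<close>
  consider "S \<inter> V = {}" | "S \<inter> V = V" | "S \<inter> V \<subset> V" "S \<inter> V \<noteq> {}" by blast
  then show "\<exists>u\<in>S. \<exists>v\<in>insert x V - S. (u, v) \<in> E"
  proof cases
    case 1
    then have "x \<in> S" "p \<notin> S" using S assms(3) by auto
    then show ?thesis using xp assms(3) by auto
  next
    case 2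
    then have "x \<notin> S" "p \<in> S" using S assms(3) by auto
    then show ?thesis using assms(4) by auto
  next
    case 3
    then obtain u v where "u \<in> S \<inter> V" "v \<in> V" "v \<notin> S \<inter> V" "(u, v) \<in> E"
      using assms(2) by (elim set_connectedE)
    then show ?thesis by auto
  qed
qed

lemma ex_removable_vertex:
  assumes "finite V" "sym E" "set_connected E V" "r \<in> V" "V \<noteq> {r}"
  obtains l p where "l \<in> V" "l \<noteq> r" "p \<in> V - {l}" "(p, l) \<in> E" "set_connected E (V - {l})"
proof -
  \<comment> \<open>A maximal connected proper subset containing \<open>r\<close> misses exactly one vertex.\<close>
  define C where "C = {S. r \<in> S \<and> S \<subset> V \<and> set_connected E S}"
  have "finite C" using assms(1) by (auto simp: C_def intro: finite_subset[of _ "Pow V"])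
  moreover have "{r} \<in> C" using assms(4,5) by (auto simp: C_def set_connected_def)
  ultimately obtain S where S: "S \<in> C" and max: "\<And>T. T \<in> C \<Longrightarrow> S \<subseteq> T \<Longrightarrow> S = T"
    by (metis finite_has_maximal2)
  have "S \<subset> V" "S \<noteq> {}" using S by (auto simp: C_def)
  then obtain p l where pl: "p \<in> S" "l \<in> V" "l \<notin> S" "(p, l) \<in> E"
    using assms(3) by (elim set_connectedE)
  have "set_connected E (insert l S)"
    using S pl assms(2) by (intro set_connected_insert[of _ _ p]) (auto simp: C_def)
  then have "insert l S \<notin> C" using max[of "insert l S"] pl by auto
  then have "insert l S = V"
    using S pl \<open>set_connected E (insert l S)\<close> by (auto simp: C_def)
  then have "S = V - {l}" using pl by auto
  then show ?thesis using S pl by (intro that[of l p]) (auto simp: C_def)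
qed

section \<open>Degree-weighted sums over homomorphisms\<close>

text \<open>Only edges inside \<open>V\<close> constrain \<open>f\<close>, so vertices can be
  deleted by shrinking \<open>V\<close> while \<open>E\<close> stays fixed.\<close>

definition set_homs :: "('a \<times> 'a) set \<Rightarrow> ('b \<times> 'b) set \<Rightarrow> 'b set \<Rightarrow> 'a set \<Rightarrow> ('a \<Rightarrow> 'b) set" where
  "set_homs E F W V =
     {f \<in> V \<rightarrow>\<^sub>E W. \<forall>u\<in>V. \<forall>v\<in>V. (u, v) \<in> E \<longrightarrow> (f u, f v) \<in> F}"

lemma finite_set_homs: "finite V \<Longrightarrow> finite W \<Longrightarrow> finite (set_homs E F W V)"
  by (rule finite_subset[OF _ finite_PiE[of V "\<lambda>_. W"]]) (auto simp: set_homs_def)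

text \<open>A homomorphism is determined by its restriction to \<open>V\<close> and its value at
  \<open>l\<close>, which must be a neighbour of the image of \<open>p\<close>. Other edges at
  \<open>l\<close> only exclude further values.\<close>

lemma sum_homs_remove_le:
  fixes w :: "('a \<Rightarrow> 'b) \<Rightarrow> nat"
  assumes fin: "finite V" "finite W" and "l \<notin> V" "p \<in> V" "(p, l) \<in> E"
    and w: "\<And>f. w (restrict f V) = w f"
  shows "(\<Sum>f\<in>set_homs E F W (insert l V). w f)
           \<le> (\<Sum>g\<in>set_homs E F W V. card (W \<inter> F `` {g p}) * w g)"
proof -
  let ?S = "SIGMA g:set_homs E F W V. W \<inter> F `` {g p}"
  let ?h = "\<lambda>f. (restrict f V, f l)"
  have inj: "inj_on ?h (set_homs E F W (insert l V))"
  proof (rule inj_onI)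
    fix f g assume fg: "f \<in> set_homs E F W (insert l V)" "g \<in> set_homs E F W (insert l V)"
      and eq: "?h f = ?h g"
    have "f v = g v" if "v \<in> insert l V" for v
      using eq that by (auto dest: fun_cong[of _ _ v])
    then show "f = g" using fg by (auto simp: set_homs_def intro: PiE_ext)
  qed
  have "?h ` set_homs E F W (insert l V) \<subseteq> ?S"
    using assms(4,5) by (auto simp: set_homs_def)
  then have "(\<Sum>z\<in>?h ` set_homs E F W (insert l V). w (fst z)) \<le> (\<Sum>z\<in>?S. w (fst z))"
    using fin by (intro sum_mono2) (auto intro!: finite_SigmaI finite_set_homs)
  also have "(\<Sum>z\<in>?h ` set_homs E F W (insert l V). w (fst z))
      = (\<Sum>f\<in>set_homs E F W (insert l V). w f)"
    using inj by (simp add: sum.reindex w)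
  also have "(\<Sum>z\<in>?S. w (fst z)) = (\<Sum>g\<in>set_homs E F W V. \<Sum>y\<in>W \<inter> F `` {g p}. w g)"
    using fin by (subst sum.Sigma) (auto intro!: finite_set_homs simp: case_prod_beta)
  finally show ?thesis by simp
qed

lemma sum_homs_singleton_le:
  fixes w :: "'b \<Rightarrow> nat"
  assumes "finite W"
  shows "(\<Sum>f\<in>set_homs E F W {r}. w (f r)) \<le> sum w W"
proof -
  have inj: "inj_on (\<lambda>f. f r) (set_homs E F W {r})"
    by (rule inj_onI) (auto simp: set_homs_def intro: PiE_ext)
  have "(\<Sum>f\<in>set_homs E F W {r}. w (f r)) = sum w ((\<lambda>f. f r) ` set_homs E F W {r})"
    using inj by (simp add: sum.reindex)
  also have "\<dots> \<le> sum w W"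
    using assms by (intro sum_mono2) (auto simp: set_homs_def)
  finally show ?thesis .
qed

lemma sum_homs_degree_powers_le:
  fixes E :: "('a \<times> 'a) set" and F :: "('b \<times> 'b) set" and W :: "'b set"
  defines "d \<equiv> \<lambda>x. card (W \<inter> F `` {x})"
  assumes "finite V" "finite W" "sym E" "set_connected E V" "card V = Suc n"
  shows "(\<Sum>f\<in>set_homs E F W V. \<Prod>v\<in>V. d (f v) ^ a v) \<le> (\<Sum>x\<in>W. d x ^ (n + sum a V))"
  using assms(2,5,6)
proof (induction n arbitrary: V a)
  case 0
  then obtain r where "V = {r}" by (auto simp: card_Suc_eq)
  then show ?case
    using sum_homs_singleton_le[OF assms(3), where r = r and w = "\<lambda>x. d x ^ a r"] by simp
next
  case (Suc n)
  \<comment> \<open>The deletion step, stated for an arbitrary weight because it is applied to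
    \<open>?al\<close>, \<open>?am\<close> and the original weight.\<close>
  have fold: "(\<Sum>f\<in>set_homs E F W V. \<Prod>v\<in>V. d (f v) ^ a v)
                \<le> (\<Sum>x\<in>W. d x ^ (Suc n + sum a V))"
    if "a l = 0" "l \<in> V" "p \<in> V - {l}" "(p, l) \<in> E" "set_connected E (V - {l})" for a l p
  proof -
    let ?V = "V - {l}"
    let ?a = "a(p := Suc (a p))"
    have fin: "finite ?V" using Suc.prems by simp
    have V: "V = insert l ?V" using that by auto
    have "(\<Prod>v\<in>V. d (f v) ^ a v) = (\<Prod>v\<in>?V. d (f v) ^ a v)" for f
      using that Suc.prems by (simp add: prod.remove[of V l])
    then have "(\<Sum>f\<in>set_homs E F W V. \<Prod>v\<in>V. d (f v) ^ a v)
        = (\<Sum>f\<in>set_homs E F W (insert l ?V). \<Prod>v\<in>?V. d (f v) ^ a v)"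
      using V by simp
    also have "\<dots> \<le> (\<Sum>g\<in>set_homs E F W ?V. card (W \<inter> F `` {g p}) * (\<Prod>v\<in>?V. d (g v) ^ a v))"
      using that fin assms(3) by (intro sum_homs_remove_le) (auto intro!: prod.cong)
    also have "\<dots> = (\<Sum>g\<in>set_homs E F W ?V. \<Prod>v\<in>?V. d (g v) ^ ?a v)"
    proof (rule sum.cong)
      fix g
      have "(\<Prod>v\<in>?V - {p}. d (g v) ^ ?a v) = (\<Prod>v\<in>?V - {p}. d (g v) ^ a v)"
        by (intro prod.cong) auto
      then show "card (W \<inter> F `` {g p}) * (\<Prod>v\<in>?V. d (g v) ^ a v) = (\<Prod>v\<in>?V. d (g v) ^ ?a v)"
        using that(3) fin by (simp add: prod.remove[of ?V p] d_def)
    qed simp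
    also have "\<dots> \<le> (\<Sum>x\<in>W. d x ^ (n + sum ?a ?V))"
      using that Suc.prems by (intro Suc.IH) auto
    \<comment> \<open>The vertex lost from the count reappears as one unit of weight at
      \<open>p\<close>, so the total exponent is unchanged.\<close>
    also have "sum ?a ?V = Suc (sum a V)"
    proof -
      have "sum ?a (?V - {p}) = sum a (?V - {p})" by (intro sum.cong) auto
      then have "sum ?a ?V = Suc (sum a ?V)"
        using that(3) fin by (simp add: sum.remove[of ?V p])
      then show ?thesis using that Suc.prems by (simp add: sum.remove[of V l])
    qed
    finally show ?thesis by simp
  qed
  have "V \<noteq> {}" "V \<noteq> {r}" for r using Suc.prems by auto
  then obtain r where "r \<in> V" "V \<noteq> {r}" by auto
  then obtain l p where l: "l \<in> V" "p \<in> V - {l}" "(p, l) \<in> E" "set_connected E (V - {l})"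
    using Suc.prems assms(4) by (elim ex_removable_vertex)
  \<comment> \<open>Here \<open>l\<close> is the vertex to be kept, which forces \<open>m\<close> to
    differ from it.\<close>
  obtain m q where m: "m \<in> V" "m \<noteq> l" "q \<in> V - {m}" "(q, m) \<in> E" "set_connected E (V - {m})"
    using Suc.prems assms(4) l(1) \<open>V \<noteq> {l}\<close> by (elim ex_removable_vertex)
  let ?U = "V - {l} - {m}"
  let ?s = "a l + a m"
  let ?al = "a(l := ?s, m := 0)"
  let ?am = "a(l := 0, m := ?s)"
  let ?T = "\<lambda>a. \<Sum>f\<in>set_homs E F W V. \<Prod>v\<in>V. d (f v) ^ a v"
  let ?R = "\<Sum>x\<in>W. d x ^ (Suc n + sum a V)"
  have m': "m \<in> V - {l}" using m by simp
  have fin: "finite V" "finite (V - {l})" using Suc.prems by auto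
  \<comment> \<open>The weights \<open>a\<close>, \<open>?al\<close> and \<open>?am\<close> agree on
    \<open>?U\<close>, so their products share this factor and only the powers at \<open>l\<close>
    and \<open>m\<close> need comparison.\<close>
  have split: "(\<Prod>v\<in>V. d (f v) ^ b v) = d (f l) ^ b l * d (f m) ^ b m * (\<Prod>v\<in>?U. d (f v) ^ a v)"
    if "\<And>v. v \<in> ?U \<Longrightarrow> b v = a v" for f b
  proof -
    have "(\<Prod>v\<in>?U. d (f v) ^ b v) = (\<Prod>v\<in>?U. d (f v) ^ a v)"
      using that by (intro prod.cong) auto
    then show ?thesis
      by (simp add: prod.remove[OF fin(1) l(1)] prod.remove[OF fin(2) m'] mult.assoc)
  qed
  have split_sum: "sum b V = b l + b m + sum a ?U" if "\<And>v. v \<in> ?U \<Longrightarrow> b v = a v" for b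
  proof -
    have "sum b ?U = sum a ?U" using that by (intro sum.cong) auto
    then show ?thesis
      by (simp add: sum.remove[OF fin(1) l(1)] sum.remove[OF fin(2) m'] add.assoc)
  qed
  have sums: "sum ?al V = sum a V" "sum ?am V = sum a V"
    using split_sum[of a] split_sum[of ?al] split_sum[of ?am] m(2) by auto
  have Tl: "?T ?al \<le> ?R" using fold[of ?al m q] m sums by simp
  have Tm: "?T ?am \<le> ?R" using fold[of ?am l p] l m(2) sums by simp
  show ?case
  \<comment> \<open>The averaging below ends by cancelling \<open>?s\<close>. If \<open>?s\<close>
    is 0, then \<open>l\<close> already has weight 0 and can be deleted directly.\<close>
  proof (cases "?s = 0")
    case True
    then show ?thesis using fold[of a l p] l by simp
  next
    case False
    have "?s * ?T a \<le> a l * ?T ?al + a m * ?T ?am"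
      unfolding sum_distrib_left sum.distrib[symmetric]
    proof (rule sum_mono)
      fix f
      have "?s * (d (f l) ^ a l * d (f m) ^ a m) * (\<Prod>v\<in>?U. d (f v) ^ a v)
          \<le> (a l * d (f l) ^ ?s + a m * d (f m) ^ ?s) * (\<Prod>v\<in>?U. d (f v) ^ a v)"
        by (intro mult_right_mono weighted_AM_GM_nat) auto
      then show "?s * (\<Prod>v\<in>V. d (f v) ^ a v)
          \<le> a l * (\<Prod>v\<in>V. d (f v) ^ ?al v) + a m * (\<Prod>v\<in>V. d (f v) ^ ?am v)"
        using split[of a f] split[of ?al f] split[of ?am f] m(2)
        by (simp add: algebra_simps)
    qed
    also have "\<dots> \<le> a l * ?R + a m * ?R"
      using Tl Tm by (intro add_mono mult_left_mono) auto
    also have "\<dots> = ?s * ?R" by (simp add: distrib_right)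
    finally show ?thesis using False by auto
  qed
qed

section \<open>Counting homomorphisms from the star\<close>

text \<open>Choose an image \<open>x\<close> of the centre, then map the \<open>k\<close> leaves
  independently to neighbours of \<open>x\<close>; different choices give different
  homomorphisms.\<close>

lemma sum_degree_powers_le_card_star_homs:
  assumes "pair_graph H"
  shows "(\<Sum>x\<in>pverts H. card (pverts H \<inter> parcs H `` {x}) ^ k)
           \<le> card (graph_homs (star_graph k) H)"
proof -
  interpret H: pair_graph H by fact
  let ?N = "\<lambda>x. pverts H \<inter> parcs H `` {x}"
  let ?S = "SIGMA x:pverts H. {1..k} \<rightarrow>\<^sub>E ?N x"
  let ?h = "\<lambda>(x, g). g(0 := x)"
  have symH: "(y, x) \<in> parcs H" if "(x, y) \<in> parcs H" for x y
    using that by (rule H.arcs_symmetric)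
  have "inj_on ?h ?S"
  proof (rule inj_onI, clarify)
    fix x g y h
    assume gh: "g \<in> {1..k} \<rightarrow>\<^sub>E ?N x" "h \<in> {1..k} \<rightarrow>\<^sub>E ?N y" and eq: "g(0 := x) = h(0 := y)"
    \<comment> \<open>The centre 0 lies outside \<open>{1..k}\<close>, so the update at 0 hides no
      leaf value.\<close>
    have "g v = h v" if "v \<in> {1..k}" for v
      using fun_cong[OF eq, of v] that by simp
    then have "g = h"
      using gh by (intro extensionalityI[of _ "{1..k}"]) (auto simp: PiE_def)
    then show "x = y \<and> g = h" using fun_cong[OF eq, of 0] by simp
  qed
  moreover have "?h ` ?S \<subseteq> graph_homs (star_graph k) H"
    by (fastforce simp: graph_homs_def star_graph_def PiE_def extensional_def Pi_def
        intro: symH)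
  ultimately have "card ?S \<le> card (graph_homs (star_graph k) H)"
    by (intro card_inj_on_le[of ?h] finite_graph_homs pair_graph_star_graph assms)
  moreover have "card ?S = (\<Sum>x\<in>pverts H. card (?N x) ^ k)"
    by (subst card_SigmaI) (auto intro!: finite_PiE simp: card_PiE)
  ultimately show ?thesis by simp
qed

section \<open>Passage from graphs to sets of arcs\<close>

lemma graph_homs_eq_set_homs:
  assumes "pair_graph G"
  shows "graph_homs G H = set_homs (parcs G) (parcs H) (pverts H) (pverts G)"
proof -
  interpret G: pair_graph G by fact
  have "u \<in> pverts G \<and> v \<in> pverts G" if "(u, v) \<in> parcs G" for u v
    using G.arc_fst_in_verts[OF that] G.arc_snd_in_verts[OF that] by simp
  then show ?thesis
    by (auto simp: graph_homs_def set_homs_def)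
qed

text \<open>A set that no arc leaves is closed under reachability, so a proper nonempty one would
  contradict connectedness.\<close>

lemma set_connected_parcs:
  assumes "pair_graph G" "Digraph_Component.connected (with_proj G)"
  shows "set_connected (parcs G) (pverts G)"
  unfolding set_connected_def
proof (intro allI impI, rule ccontr)
  interpret G: pair_graph G by fact
  fix S assume S: "S \<subset> pverts G" "S \<noteq> {}"
    and no: "\<not> (\<exists>x\<in>S. \<exists>y\<in>pverts G - S. (x, y) \<in> parcs G)"
  obtain x y where xy: "x \<in> S" "y \<in> pverts G" "y \<notin> S" using S by auto
  \<comment> \<open>Connectedness is defined through the symmetric closure, which adds no arcs to
    \<open>G\<close>.\<close>
  have ends: "parcs (mk_symmetric (with_proj G)) = parcs G"
    using G.pair_sym_arcs by (rule G.adj_mk_symmetric_eq)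
  have "x \<rightarrow>\<^sup>*\<^bsub>with_proj (mk_symmetric G)\<^esub> y"
    using assms(2) xy S by (auto simp: connected_def strongly_connected_def mk_symmetric_def)
  then have "(x, y) \<in> (parcs G)\<^sup>*"
    unfolding ends[symmetric] by (auto dest: reachable_rtranclI)
  then have "y \<in> S"
  proof (induction rule: rtrancl_induct)
    case (step u v)
    then show ?case using no G.arc_snd_in_verts[of "(u, v)"] by auto
  qed (use xy in simp)
  then show False using xy by simp
qed

theorem theorem1:
  fixes k :: nat and G :: "'a pair_pre_digraph" and H :: "'b pair_pre_digraph"
  assumes "pair_graph G" and "Digraph_Component.connected (with_proj G)"
    and "card (pverts G) = k + 1"
    and "pair_graph H"
  shows "card (graph_homs G H) \<le> card (graph_homs (star_graph k) H)"
proof -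
  interpret G: pair_graph G by fact
  interpret H: pair_graph H by fact
  \<comment> \<open>With weight 0 every product is 1, so the sum counts homomorphisms and the
    exponent is \<open>k\<close>.\<close>
  have "card (graph_homs G H) \<le> (\<Sum>x\<in>pverts H. card (pverts H \<inter> parcs H `` {x}) ^ k)"
    using sum_homs_degree_powers_le[of "pverts G" "pverts H" "parcs G" k "parcs H" "\<lambda>_. 0"]
      set_connected_parcs[OF assms(1,2)] assms(3) G.sym_arcs
    by (simp add: graph_homs_eq_set_homs[OF assms(1)] symmetric_def)
  also have "\<dots> \<le> card (graph_homs (star_graph k) H)"
    by (rule sum_degree_powers_le_card_star_homs[OF assms(4)])
  finally show ?thesis .
qed

end
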